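(* Let $(X,Y)$ be a pair of random variables with finite alphabets and joint pmf $p_{X,Y}$, and let $R^*$ be the exact common information rate of the discrete memoryless source $(X,Y)$. Then $$R^*=\overline{G}(X;Y).$$
   Context: All random variables are discrete; $H$ denotes Shannon entropy (base 2). $A\to W\to B$ means $A$ and $B$ are conditionally independent given $W$. Let $(X_i,Y_i)$, $i=1,2,\dots$, be i.i.d. with pmf $p_{X,Y}$. Define $G(X^n;Y^n)=\min_{W_n:\,X^n\to W_n\to Y^n}H(W_n)$, the minimum being over all discrete $W_n$ jointly distributed with $(X^n,Y^n)$ (whose joint pmf is fixed) satisfying the Markov condition, and $\overline{G}(X;Y)=\lim_{n\to\infty}\frac1nG(X^n;Y^n)$ (this limit exists and equals $\inf_n\frac1nG(X^n;Y^n)$). A $(W_n,R,n)$ simulation code consists of: (i) a discrete common random variable $W_n$, with $R=\frac1n\min_{\mathcal C}\mathsf{E}(L)$, where the minimum is over all variable-length prefix-free zero-error binary codes $\mathcal C\subset\{0,1\}^*$ for $W_n$ and $L$ is the length of the codeword of $W_n$; (ii) stochastic decoders $p_{\hat X^n|W_n}$ and $p_{\hat Y^n|W_n}$, with $\hat X^n$ and $\hat Y^n$ conditionally independent given $W_n$. It exactly generates $(X^n,Y^n)$ if $p_{\hat X^n,\hat Y^n}(x^n,y^n)=\prod_{i=1}^np_{X,Y}(x_i,y_i)$ for all $(x^n,y^n)$. The source $(X,Y)$ can be exactly generated at rate $R$ if for some $n\ge1$ there exists a $(W_n,R,n)$ simulation code that exactly generates $(X^n,Y^n)$. The exact common information rate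 $R^*$ is the infimum of all rates $R$ at which $(X,Y)$ can be exactly generated. *)

theory Defs
  imports "HOL-Probability.Probability" "HOL-Library.Sublist"
begin

(* Entropy is valued in ennreal because a distribution on a countably infinite alphabet can have
   infinite entropy; the library's real-valued entropy would be 0 in that case. *)

definition shannon_entropy :: "'w pmf \<Rightarrow> ennreal" where
  "shannon_entropy W = (\<integral>\<^sup>+ w. ennreal (- log 2 (pmf W w)) \<partial>measure_pmf W)"

(* A \<rightarrow> W \<rightarrow> B for a joint distribution of the triple (A, W, B). *)

definition markov_chain :: "('a \<times> 'w \<times> 'b) pmf \<Rightarrow> bool" where
  "markov_chain q \<longleftrightarrow>
     (\<forall>w \<in> set_pmf (map_pmf (\<lambda>(_, w, _). w) q). \<forall>a b.
        \<P>((a', w', b') in measure_pmf q. a' = a \<and> b' = b \<bar> w' = w) =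
        \<P>((a', w', b') in measure_pmf q. a' = a \<bar> w' = w) *
        \<P>((a', w', b') in measure_pmf q. b' = b \<bar> w' = w))"

definition iid_source :: "nat \<Rightarrow> ('a \<times> 'b) pmf \<Rightarrow> ('a list \<times> 'b list) pmf" where
  "iid_source n p = map_pmf (\<lambda>zs. (map fst zs, map snd zs)) (replicate_pmf n p)"

(* Discrete random variables W are taken with values in nat: a discrete distribution has countable
   support, and all notions below are invariant under relabelling the values of W. Minima over W, and below over codes, are written as
   infima. *)

definition common_entropy :: "nat \<Rightarrow> ('a \<times> 'b) pmf \<Rightarrow> ennreal" where
  "common_entropy n p =
     (INF q \<in> {q :: ('a list \<times> nat \<times> 'b list) pmf.
                map_pmf (\<lambda>(xs, _, ys). (xs, ys)) q = iid_source n p \<and> markov_chain q}.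
        shannon_entropy (map_pmf (\<lambda>(_, w, _). w) q))"

definition common_entropy_rate :: "('a \<times> 'b) pmf \<Rightarrow> ennreal" where
  "common_entropy_rate p = lim (\<lambda>n. common_entropy n p / of_nat n)"

(* Injectivity is the zero-error requirement; only symbols of positive probability are encoded. *)

definition prefix_free_code :: "'w pmf \<Rightarrow> ('w \<Rightarrow> bool list) \<Rightarrow> bool" where
  "prefix_free_code W c \<longleftrightarrow>
     inj_on c (set_pmf W) \<and>
     (\<forall>u \<in> set_pmf W. \<forall>v \<in> set_pmf W. \<not> strict_prefix (c u) (c v))"

definition expected_length :: "'w pmf \<Rightarrow> ('w \<Rightarrow> bool list) \<Rightarrow> ennreal" where
  "expected_length W c = (\<integral>\<^sup>+ w. of_nat (length (c w)) \<partial>measure_pmf W)"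

definition simulation_code ::
    "nat pmf \<Rightarrow> ennreal \<Rightarrow> nat \<Rightarrow> (nat \<Rightarrow> 'a list pmf) \<Rightarrow> (nat \<Rightarrow> 'b list pmf) \<Rightarrow> bool" where
  "simulation_code W R n dec\<^sub>X dec\<^sub>Y \<longleftrightarrow>
     R = (INF c \<in> {c. prefix_free_code W c}. expected_length W c) / of_nat n \<and>
     (\<forall>w \<in> set_pmf W. \<forall>xs \<in> set_pmf (dec\<^sub>X w). length xs = n) \<and>
     (\<forall>w \<in> set_pmf W. \<forall>ys \<in> set_pmf (dec\<^sub>Y w). length ys = n)"

(* Given w, the two decoders act independently, hence the product distribution. *)

definition decoder_output ::
    "nat pmf \<Rightarrow> (nat \<Rightarrow> 'a list pmf) \<Rightarrow> (nat \<Rightarrow> 'b list pmf) \<Rightarrow> ('a list \<times> 'b list) pmf" where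
  "decoder_output W dec\<^sub>X dec\<^sub>Y = bind_pmf W (\<lambda>w. pair_pmf (dec\<^sub>X w) (dec\<^sub>Y w))"

definition exactly_generates ::
    "nat \<Rightarrow> ('a \<times> 'b) pmf \<Rightarrow> nat pmf \<Rightarrow> (nat \<Rightarrow> 'a list pmf) \<Rightarrow> (nat \<Rightarrow> 'b list pmf) \<Rightarrow> bool" where
  "exactly_generates n p W dec\<^sub>X dec\<^sub>Y \<longleftrightarrow>
     (\<forall>xs ys. length xs = n \<longrightarrow> length ys = n \<longrightarrow>
        pmf (decoder_output W dec\<^sub>X dec\<^sub>Y) (xs, ys) = (\<Prod>i<n. pmf p (xs ! i, ys ! i)))"

definition exactly_generated_at_rate :: "('a \<times> 'b) pmf \<Rightarrow> ennreal \<Rightarrow> bool" where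
  "exactly_generated_at_rate p R \<longleftrightarrow>
     (\<exists>n\<ge>1. \<exists>W dec\<^sub>X dec\<^sub>Y. simulation_code W R n dec\<^sub>X dec\<^sub>Y \<and> exactly_generates n p W dec\<^sub>X dec\<^sub>Y)"

definition exact_common_information_rate :: "('a \<times> 'b) pmf \<Rightarrow> ennreal" where
  "exact_common_information_rate p = Inf {R. exactly_generated_at_rate p R}"

lemma pmf_replicate_pmf:
  "length zs = n \<Longrightarrow> pmf (replicate_pmf n p) zs = (\<Prod>i<n. pmf p (zs ! i))"
proof (induction n arbitrary: zs)
  case 0
  then show ?case by simp
next
  case (Suc n)
  then obtain z zs' where zs: "zs = z # zs'" "length zs' = n"
    by (cases zs) auto
  have eq: "replicate_pmf (Suc n) p =
      map_pmf (\<lambda>(x, xs). x # xs) (pair_pmf p (replicate_pmf n p))"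
    by (simp add: pair_pmf_def map_bind_pmf)
  have "inj (\<lambda>(x, xs). x # xs :: 'a list)"
    by (auto simp: inj_on_def)
  from pmf_map_inj'[OF this, of "pair_pmf p (replicate_pmf n p)" "(z, zs')"]
  have "pmf (replicate_pmf (Suc n) p) zs = pmf p z * pmf (replicate_pmf n p) zs'"
    unfolding eq zs by (simp add: pmf_pair)
  then show ?case
    using Suc.IH[OF zs(2)] zs(1) by (simp add: prod.lessThan_Suc_shift del: prod.lessThan_Suc)
qed

lemma pmf_iid_source:
  assumes "length xs = n" "length ys = n"
  shows "pmf (iid_source n p) (xs, ys) = (\<Prod>i<n. pmf p (xs ! i, ys ! i))"
proof -
  have "inj (\<lambda>zs :: ('a \<times> 'b) list. (map fst zs, map snd zs))"
    by (rule injI) (metis prod.inject zip_map_fst_snd)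
  from pmf_map_inj'[OF this, of "replicate_pmf n p" "zip xs ys"]
  have "pmf (iid_source n p) (xs, ys) = pmf (replicate_pmf n p) (zip xs ys)"
    using assms by (simp add: iid_source_def)
  also have "\<dots> = (\<Prod>i<n. pmf p (zip xs ys ! i))"
    using assms by (intro pmf_replicate_pmf) simp
  also have "\<dots> = (\<Prod>i<n. pmf p (xs ! i, ys ! i))"
    using assms by (intro prod.cong) auto
  finally show ?thesis .
qed

end

theory Submission
  imports Defs
begin

text \<open>Conditional independence given \<open>W\<close> means exactly that \<open>(X\<^sup>n, Y\<^sup>n)\<close> is the output of two
  independent decoders fed with \<open>W\<close>, so \<open>G(X\<^sup>n; Y\<^sup>n)\<close> is the least entropy of a common random
  variable from which \<open>(X\<^sup>n, Y\<^sup>n)\<close> can be generated. The optimal expected length of a prefix-free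
  code for \<open>W\<close> lies between \<open>H(W)\<close> (Kraft and Gibbs) and \<open>H(W) + 2\<close> (Shannon--Fano--Elias).
  Hence \<open>inf\<^sub>n G/n \<le> R\<^sup>* \<le> (G + 2)/n\<close> for every \<open>n\<close>, and \<open>G/n\<close> tends to its infimum by Fekete's
  lemma.\<close>

section \<open>Prefix-free codes and entropy\<close>

text \<open>Pad all codewords to a common length \<open>N\<close>: prefix-freeness makes their sets
  of extensions disjoint, and all of them fit among the \<open>2 ^ N\<close> words of that
  length.\<close>

lemma kraft_inequality_finite:
  fixes c :: "'w \<Rightarrow> bool list"
  assumes "finite S" "inj_on c S"
    and "\<And>u v. u \<in> S \<Longrightarrow> v \<in> S \<Longrightarrow> \<not> strict_prefix (c u) (c v)"
  shows "(\<Sum>w\<in>S. (1 / 2) ^ length (c w)) \<le> (1 :: real)"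
proof -
  \<comment> \<open>Inserting 0 keeps \<open>Max\<close> meaningful when \<open>S\<close> is
    empty.\<close>
  define N where "N = Max (insert 0 ((length \<circ> c) ` S))"
  have len: "length (c w) \<le> N" if "w \<in> S" for w
    unfolding N_def using assms(1) that by (intro Max_ge) auto
  have card_words: "card {xs :: bool list. length xs = k} = 2 ^ k" for k
    using card_lists_length_eq[of "UNIV :: bool set" k] by simp
  have fin_words: "finite {xs :: bool list. length xs = k}" for k
    using finite_lists_length_eq[of "UNIV :: bool set" k] by simp
  define E where "E w = (\<lambda>ys. c w @ ys) ` {ys. length ys = N - length (c w)}" for w
  have card_E: "card (E w) = 2 ^ (N - length (c w))" for w
    unfolding E_def by (subst card_image) (auto simp: inj_on_def card_words)
  have disj: "E u \<inter> E v = {}" if "u \<in> S" "v \<in> S" "u \<noteq> v" for u v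
  proof (rule ccontr)
    assume "E u \<inter> E v \<noteq> {}"
    then obtain xs where "prefix (c u) xs" "prefix (c v) xs"
      unfolding E_def by (auto simp: prefix_def)
    then have "prefix (c u) (c v) \<or> prefix (c v) (c u)"
      using prefix_same_cases by blast
    moreover have "c u \<noteq> c v"
      using assms(2) that by (auto dest: inj_onD)
    ultimately show False
      using assms(3)[of u v] assms(3)[of v u] that by (auto simp: strict_prefix_def)
  qed
  have weight: "(1 / 2) ^ length (c w) * 2 ^ N = real (card (E w))" if "w \<in> S" for w
  proof -
    have "(2 :: real) ^ N = 2 ^ (N - length (c w)) * 2 ^ length (c w)"
      using len[OF that] by (simp flip: power_add)
    then show ?thesis
      by (simp add: card_E power_divide)
  qed
  have "(\<Sum>w\<in>S. (1 / 2) ^ length (c w)) * 2 ^ N = (\<Sum>w\<in>S. real (card (E w)))"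
    unfolding sum_distrib_right by (intro sum.cong) (auto simp: weight)
  also have "\<dots> = real (card (\<Union>w\<in>S. E w))"
    using assms(1) disj by (subst card_UN_disjoint) (auto simp: E_def fin_words)
  also have "\<dots> \<le> real (card {xs :: bool list. length xs = N})"
    using len by (intro of_nat_mono card_mono fin_words) (auto simp: E_def)
  also have "\<dots> = 2 ^ N"
    by (simp add: card_words)
  finally show ?thesis
    by simp
qed

text \<open>\<open>ennreal\<close> truncates negative reals, so the splitting rests on
  \<open>pmf W w \<le> 1\<close>. At probability 0 the convention \<open>ln 0 = 0\<close> makes the
  logarithm vanish.\<close>

lemma ennreal_add_neg_log_pmf:
  assumes "0 \<le> x"
  shows "ennreal (x - log 2 (pmf W w)) = ennreal x + ennreal (- log 2 (pmf W w))"
proof (cases "pmf W w = 0")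
  case False
  then have "log 2 (pmf W w) \<le> 0"
    by (intro log_le_zero_cancel_iff[THEN iffD2]) (auto simp: pmf_le_1 pmf_pos)
  then show ?thesis
    using assms ennreal_plus[of x "- log 2 (pmf W w)"] by simp
qed (use assms in \<open>simp add: log_def\<close>)

text \<open>Gibbs' inequality: apply \<open>ln t \<le> t - 1\<close> at
  \<open>t = k w / pmf W w\<close> and average over \<open>W\<close>; Kraft bounds the mean of
  \<open>t\<close> by 1.\<close>

lemma entropy_le_expected_length:
  fixes W :: "nat pmf"
  assumes "prefix_free_code W c"
  shows "shannon_entropy W \<le> expected_length W c"
proof -
  \<comment> \<open>With value 0 off the support, the sum of \<open>k\<close> over all naturals is
    both the Kraft sum and the mean of \<open>k w / pmf W w\<close>.\<close>
  define k where "k w = (if w \<in> set_pmf W then (1 / 2) ^ length (c w) else 0 :: real)" for w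
  have k_nonneg: "0 \<le> k w" for w
    by (simp add: k_def)
  have "(\<Sum>w. ennreal (k w)) \<le> 1"
  proof (intro suminf_le_const)
    fix n
    have "(\<Sum>w<n. k w) = (\<Sum>w\<in>{..<n} \<inter> set_pmf W. (1 / 2) ^ length (c w))"
      by (simp add: k_def sum.inter_restrict)
    also have "\<dots> \<le> 1"
      using assms unfolding prefix_free_code_def
      by (intro kraft_inequality_finite) (auto intro: inj_on_subset)
    finally have "ennreal (\<Sum>w<n. k w) \<le> 1"
      by simp
    then show "(\<Sum>w<n. ennreal (k w)) \<le> 1"
      by (subst sum_ennreal) (auto simp: k_nonneg)
  qed auto
  moreover have "(\<integral>\<^sup>+ w. ennreal (k w / pmf W w) \<partial>measure_pmf W) = (\<Sum>w. ennreal (k w))"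
    unfolding nn_integral_measure_pmf nn_integral_count_space_nat
    by (intro suminf_cong)
       (auto simp: k_def set_pmf_iff k_nonneg simp flip: ennreal_mult)
  ultimately have kraft: "(\<integral>\<^sup>+ w. ennreal (k w / pmf W w) \<partial>measure_pmf W) \<le> 1"
    by simp
  \<comment> \<open>The constant \<open>1 / ln 2\<close> is the 1 of \<open>ln t \<le> t - 1\<close>
    in base 2. It stays on the left to avoid subtraction in \<open>ennreal\<close>; after
    integration it cancels against the Kraft term because it is finite.\<close>
  have gibbs: "1 / ln 2 - log 2 (pmf W w) \<le> length (c w) + k w / pmf W w / ln 2"
    if "w \<in> set_pmf W" for w
  proof -
    have pos: "0 < pmf W w" "0 < k w"
      using that by (auto simp: pmf_positive k_def)
    have "ln (k w / pmf W w) \<le> k w / pmf W w - 1"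
      using pos by (intro ln_le_minus_one) simp
    moreover have "ln (k w / pmf W w) = - (length (c w) * ln 2) - ln (pmf W w)"
      using that pos by (simp add: ln_div k_def ln_realpow)
    ultimately have "(1 - ln (pmf W w)) / ln 2 \<le> (length (c w) * ln 2 + k w / pmf W w) / ln 2"
      by (intro divide_right_mono) auto
    then show ?thesis
      by (simp add: log_def diff_divide_distrib add_divide_distrib)
  qed
  have "ennreal (1 / ln 2) + shannon_entropy W =
      (\<integral>\<^sup>+ w. ennreal (1 / ln 2 - log 2 (pmf W w)) \<partial>measure_pmf W)"
    unfolding shannon_entropy_def by (simp add: ennreal_add_neg_log_pmf nn_integral_add)
  also have "\<dots> \<le> (\<integral>\<^sup>+ w. of_nat (length (c w)) + ennreal (1 / ln 2) * ennreal (k w / pmf W w)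
      \<partial>measure_pmf W)"
  proof (intro nn_integral_mono_AE, unfold AE_measure_pmf_iff, intro ballI)
    fix w assume "w \<in> set_pmf W"
    then have "ennreal (1 / ln 2 - log 2 (pmf W w)) \<le>
        ennreal (length (c w) + 1 / ln 2 * (k w / pmf W w))"
      using gibbs[of w] by (intro ennreal_leI) (simp add: mult.commute)
    also have "\<dots> = of_nat (length (c w)) + ennreal (1 / ln 2) * ennreal (k w / pmf W w)"
      by (subst ennreal_plus)
         (auto simp: k_nonneg ennreal_of_nat_eq_real_of_nat simp flip: ennreal_mult)
    finally show "ennreal (1 / ln 2 - log 2 (pmf W w)) \<le> \<dots>" .
  qed
  also have "\<dots> = expected_length W c +
      ennreal (1 / ln 2) * (\<integral>\<^sup>+ w. ennreal (k w / pmf W w) \<partial>measure_pmf W)"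
    by (simp add: expected_length_def nn_integral_add nn_integral_cmult)
  also have "\<dots> \<le> expected_length W c + ennreal (1 / ln 2) * 1"
    using kraft by (intro add_left_mono mult_left_mono) auto
  finally show ?thesis
    by (simp add: add.commute[of _ "ennreal _"] ennreal_add_left_cancel_le)
qed

text \<open>For \<open>x\<close> in \<open>[0, 1)\<close> this is the start of the binary expansion:
  scaling by \<open>2 ^ Suc i\<close> moves the digit in position \<open>Suc i\<close> after the
  point to the units place.\<close>

definition binary_digits :: "nat \<Rightarrow> real \<Rightarrow> bool list" where
  "binary_digits l x = map (\<lambda>i. odd \<lfloor>x * 2 ^ Suc i\<rfloor>) [0..<l]"

lemma length_binary_digits [simp]: "length (binary_digits l x) = l"
  by (simp add: binary_digits_def)

text \<open>Common digits force the floors of \<open>x * 2 ^ k\<close> and \<open>y * 2 ^ k\<close>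
  to agree for each \<open>k \<le> l\<close>, by induction; equal floors at \<open>k = l\<close>
  leave a scaled difference below 1.\<close>

lemma prefix_binary_digits_imp_close:
  assumes "x \<in> {0..<1}" "y \<in> {0..<1}" "prefix (binary_digits l x) (binary_digits m y)"
  shows "\<bar>x - y\<bar> < 1 / 2 ^ l"
proof -
  have lm: "l \<le> m"
    using prefix_length_le[OF assms(3)] by simp
  have digit: "odd \<lfloor>x * 2 ^ Suc i\<rfloor> \<longleftrightarrow> odd \<lfloor>y * 2 ^ Suc i\<rfloor>" if "i < l" for i
  proof -
    have "binary_digits l x ! i = binary_digits m y ! i"
      using assms(3) that by (auto simp: prefix_def nth_append)
    then show ?thesis
      using that lm by (simp add: binary_digits_def)
  qed
  have "k \<le> l \<longrightarrow> \<lfloor>x * 2 ^ k\<rfloor> = \<lfloor>y * 2 ^ k\<rfloor>" for k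
  proof (induction k)
    case 0
    have "\<lfloor>x\<rfloor> = 0" "\<lfloor>y\<rfloor> = 0"
      using assms(1,2) by (auto simp: floor_eq_iff)
    then show ?case
      by simp
  next
    case (Suc k)
    show ?case
    proof
      assume "Suc k \<le> l"
      \<comment> \<open>Halving drops the last binary digit, so the previous floor and the parity
        together determine the next floor.\<close>
      have half: "\<lfloor>z * 2 ^ Suc k\<rfloor> div 2 = \<lfloor>z * 2 ^ k\<rfloor>" for z :: real
        using floor_divide_real_eq_div[of 2 "z * 2 ^ Suc k"] by simp
      show "\<lfloor>x * 2 ^ Suc k\<rfloor> = \<lfloor>y * 2 ^ Suc k\<rfloor>"
        using half[of x] half[of y] digit[of k] Suc \<open>Suc k \<le> l\<close>
        by (metis Suc_leD Suc_le_lessD even_two_times_div_two odd_two_times_div_two_succ)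
    qed
  qed
  then have "\<lfloor>x * 2 ^ l\<rfloor> = \<lfloor>y * 2 ^ l\<rfloor>"
    by simp
  then have "\<bar>x * 2 ^ l - y * 2 ^ l\<bar> < 1"
    by linarith
  moreover have "\<bar>x * 2 ^ l - y * 2 ^ l\<bar> = \<bar>x - y\<bar> * 2 ^ l"
    by (simp add: abs_mult flip: left_diff_distrib)
  ultimately show ?thesis
    by (simp add: field_simps)
qed

text \<open>Shannon--Fano--Elias coding: the codeword of \<open>w\<close> consists of binary digits of the midpoint of
  the interval that \<open>w\<close> occupies in the cumulative distribution. Unlike the Shannon code it does
  not need the probabilities in decreasing order, so it works on infinite alphabets; the price is
  one more bit.\<close>

lemma exists_prefix_free_code:
  fixes W :: "nat pmf"
  shows "\<exists>c. prefix_free_code W c \<and> expected_length W c \<le> shannon_entropy W + 2"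
proof -
  define F where "F w = (\<Sum>v<w. pmf W v) + pmf W w / 2" for w
  \<comment> \<open>Rounding up makes \<open>2 ^ l w\<close> at least \<open>1 / pmf W w\<close>;
    the extra bit brings the truncation error down to half the width of the interval of
    \<open>w\<close>.\<close>
  define l where "l w = nat \<lceil>- log 2 (pmf W w)\<rceil> + 1" for w
  define c where "c w = binary_digits (l w) (F w)" for w
  have F01: "F w \<in> {0..<1}" if "w \<in> set_pmf W" for w
  proof -
    have "(\<Sum>v<w. pmf W v) + pmf W w = measure W {..<Suc w}"
      by (simp add: measure_measure_pmf_finite)
    also have "\<dots> \<le> 1"
      by simp
    finally have "F w < 1"
      using pmf_positive[OF that] by (simp add: F_def)
    then show ?thesis
      by (auto simp: F_def sum_nonneg)
  qed
  \<comment> \<open>Between the two midpoints lie the upper half of the interval of \<open>u\<close>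
    and the lower half of that of \<open>v\<close>.\<close>
  have gap: "(pmf W u + pmf W v) / 2 \<le> F v - F u" if "u < v" for u v
  proof -
    have "(\<Sum>i<Suc u. pmf W i) \<le> (\<Sum>i<v. pmf W i)"
      using that by (intro sum_mono2) auto
    then show ?thesis
      by (simp add: F_def field_simps)
  qed
  have len: "1 / 2 ^ l w \<le> pmf W w / 2" if "w \<in> set_pmf W" for w
  proof -
    have pos: "0 < pmf W w"
      using that by (rule pmf_positive)
    have "- log 2 (pmf W w) \<le> real (nat \<lceil>- log 2 (pmf W w)\<rceil>)"
      by linarith
    then have "2 powr - log 2 (pmf W w) \<le> 2 powr real (nat \<lceil>- log 2 (pmf W w)\<rceil>)"
      by simp
    then have "1 / pmf W w \<le> 2 ^ nat \<lceil>- log 2 (pmf W w)\<rceil>"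
      using pos by (simp add: powr_minus powr_realpow divide_simps)
    then show ?thesis
      using pos by (simp add: l_def field_simps)
  qed
  \<comment> \<open>A prefix would bring \<open>F v\<close> closer to \<open>F u\<close> than half
    the width of the interval of \<open>u\<close>, against \<open>gap\<close>.\<close>
  have not_prefix: "\<not> prefix (c u) (c v)" if "u \<in> set_pmf W" "v \<in> set_pmf W" "u \<noteq> v" for u v
  proof
    assume "prefix (c u) (c v)"
    then have "\<bar>F u - F v\<bar> < 1 / 2 ^ l u"
      unfolding c_def using that F01 by (intro prefix_binary_digits_imp_close) auto
    also have "\<dots> \<le> pmf W u / 2"
      using that by (intro len)
    finally have "\<bar>F u - F v\<bar> < pmf W u / 2" .
    moreover have "pmf W u / 2 \<le> \<bar>F u - F v\<bar>"
    proof (cases "u < v")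
      case True
      then show ?thesis
        using gap[OF True] pmf_nonneg[of W v] unfolding add_divide_distrib by linarith
    next
      case False
      then have "v < u"
        using that by simp
      then show ?thesis
        using gap[of v u] pmf_nonneg[of W v] unfolding add_divide_distrib by linarith
    qed
    ultimately show False
      by simp
  qed
  have "prefix_free_code W c"
    unfolding prefix_free_code_def
  proof (intro conjI inj_onI ballI)
    fix u v assume uv: "u \<in> set_pmf W" "v \<in> set_pmf W"
    show "\<not> strict_prefix (c u) (c v)"
      using not_prefix[OF uv] by (cases "u = v") auto
    show "u = v" if "c u = c v"
      using not_prefix[OF uv] that by auto
  qed
  moreover have "expected_length W c \<le> shannon_entropy W + 2"
  proof -
    have "expected_length W c \<le> (\<integral>\<^sup>+ w. 2 + ennreal (- log 2 (pmf W w)) \<partial>measure_pmf W)"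
      unfolding expected_length_def
    proof (intro nn_integral_mono_AE, unfold AE_measure_pmf_iff, intro ballI)
      fix w assume w: "w \<in> set_pmf W"
      \<comment> \<open>Hence \<open>nat\<close> truncates nothing and the ceiling costs at most one
        bit, besides the explicit extra bit.\<close>
      have "0 \<le> - log 2 (pmf W w)"
        using pmf_positive[OF w] pmf_le_1[of W w] by simp
      then have "real (l w) \<le> 2 - log 2 (pmf W w)"
        unfolding l_def by linarith
      then have "ennreal (real (l w)) \<le> ennreal (2 - log 2 (pmf W w))"
        by (rule ennreal_leI)
      then show "of_nat (length (c w)) \<le> 2 + ennreal (- log 2 (pmf W w))"
        by (simp add: c_def ennreal_of_nat_eq_real_of_nat ennreal_add_neg_log_pmf)
    qed
    then show ?thesis
      by (simp add: shannon_entropy_def nn_integral_add add.commute)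
  qed
  ultimately show ?thesis
    by blast
qed

section \<open>Entropy under relabelling and products\<close>

lemma shannon_entropy_map_inj:
  assumes "inj f"
  shows "shannon_entropy (map_pmf f W) = shannon_entropy W"
  unfolding shannon_entropy_def by (simp add: pmf_map_inj'[OF assms])

text \<open>On the support both terms of the split logarithm are nonnegative, so
  \<open>ennreal\<close> preserves their sum. This is the cost of independent common variables for
  two blocks.\<close>

lemma shannon_entropy_pair_pmf:
  "shannon_entropy (pair_pmf V W) = shannon_entropy V + shannon_entropy W"
proof -
  have "ennreal (- log 2 (pmf (pair_pmf V W) (v, w))) =
      ennreal (- log 2 (pmf V v)) + ennreal (- log 2 (pmf W w))"
    if "v \<in> set_pmf V" "w \<in> set_pmf W" for v w
  proof -
    have "log 2 (pmf V v) \<le> 0" "log 2 (pmf W w) \<le> 0"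
      using pmf_positive[OF that(1)] pmf_positive[OF that(2)] by (auto simp: pmf_le_1)
    then show ?thesis
      using pmf_positive[OF that(1)] pmf_positive[OF that(2)]
      by (simp add: pmf_pair log_mult flip: ennreal_plus)
  qed
  then have "shannon_entropy (pair_pmf V W) =
      (\<integral>\<^sup>+ v. \<integral>\<^sup>+ w. ennreal (- log 2 (pmf V v)) + ennreal (- log 2 (pmf W w))
        \<partial>measure_pmf W \<partial>measure_pmf V)"
    unfolding shannon_entropy_def nn_integral_pair_pmf'
    by (intro nn_integral_cong_AE) (auto simp: AE_measure_pmf_iff intro!: nn_integral_cong_AE)
  then show ?thesis
    by (simp add: shannon_entropy_def nn_integral_add)
qed

lemma shannon_entropy_finite:
  assumes "finite (set_pmf W)"
  shows "shannon_entropy W < \<top>"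
  unfolding shannon_entropy_def using assms
  by (subst nn_integral_measure_pmf_finite) (auto simp: ennreal_mult_less_top)

section \<open>Markov chains and decoders\<close>

text \<open>Take as decoders the conditional marginals of \<open>q\<close> given the middle
  component: the Markov condition makes the conditional joint law their product.\<close>

lemma markov_chain_imp_decoders:
  fixes q :: "('a list \<times> nat \<times> 'b list) pmf"
  assumes "markov_chain q"
  shows "\<exists>dX dY. decoder_output (map_pmf (\<lambda>(_, w, _). w) q) dX dY =
    map_pmf (\<lambda>(xs, _, ys). (xs, ys)) q"
proof -
  define mid :: "'a list \<times> nat \<times> 'b list \<Rightarrow> nat" where "mid = (\<lambda>(_, w, _). w)"
  define ends :: "'a list \<times> nat \<times> 'b list \<Rightarrow> 'a list \<times> 'b list"
    where "ends = (\<lambda>(xs, _, ys). (xs, ys))"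
  define W where "W = map_pmf mid q"
  define C where "C w = cond_pmf q {z. mid z = w}" for w
  define dX where "dX w = map_pmf (\<lambda>z. fst (ends z)) (C w)" for w
  define dY where "dY w = map_pmf (\<lambda>z. snd (ends z)) (C w)" for w
  \<comment> \<open>Total probability: averaging the conditional laws over \<open>W\<close> recovers
    \<open>q\<close>.\<close>
  have "bind_pmf W C = q"
    unfolding C_def
    by (intro bind_cond_pmf_cancel)
       (auto simp: W_def measure_map_pmf vimage_def intro!: arg_cong[where f = "measure q"])
  have "map_pmf ends (C w) = pair_pmf (dX w) (dY w)" if w: "w \<in> set_pmf W" for w
  proof (rule pmf_eqI, clarify)
    fix a b
    have ne: "set_pmf q \<inter> {z. mid z = w} \<noteq> {}"
      using w by (auto simp: W_def)
    have cond: "measure (C w) {z. P z} = \<P>(z in measure_pmf q. P z \<bar> mid z = w)" for P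
      unfolding C_def cond_pmf.rep_eq[OF ne] cond_prob_def
      using emeasure_measure_pmf_not_zero[OF ne]
      by (subst measure_uniform_measure) (auto simp: Int_def conj_commute)
    have "pmf (map_pmf ends (C w)) (a, b) = measure (C w) {z. fst (ends z) = a \<and> snd (ends z) = b}"
      by (auto simp: pmf_map vimage_def prod_eq_iff intro!: arg_cong[where f = "measure (C w)"])
    also have "\<dots> = measure (C w) {z. fst (ends z) = a} * measure (C w) {z. snd (ends z) = b}"
      using assms[unfolded markov_chain_def, rule_format, of w a b] w unfolding cond
      by (simp add: W_def mid_def ends_def case_prod_unfold)
    also have "\<dots> = pmf (pair_pmf (dX w) (dY w)) (a, b)"
      by (simp add: pmf_pair dX_def dY_def pmf_map vimage_def)
    finally show "pmf (map_pmf ends (C w)) (a, b) = pmf (pair_pmf (dX w) (dY w)) (a, b)" .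
  qed
  then have "decoder_output W dX dY = bind_pmf W (\<lambda>w. map_pmf ends (C w))"
    unfolding decoder_output_def by (intro bind_pmf_cong) auto
  also have "\<dots> = map_pmf ends q"
    by (simp add: \<open>bind_pmf W C = q\<close> flip: map_bind_pmf)
  finally show ?thesis
    unfolding W_def mid_def ends_def by blast
qed

text \<open>Converse construction: draw \<open>w\<close>, run both decoders independently, and
  record all three values.\<close>

lemma decoders_imp_markov_chain:
  fixes W :: "nat pmf" and dX :: "nat \<Rightarrow> 'a list pmf" and dY :: "nat \<Rightarrow> 'b list pmf"
  defines "q \<equiv> bind_pmf W (\<lambda>w. map_pmf (\<lambda>(xs, ys). (xs, w, ys)) (pair_pmf (dX w) (dY w)))"
  shows "markov_chain q"
    and "map_pmf (\<lambda>(_, w, _). w) q = W"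
    and "map_pmf (\<lambda>(xs, _, ys). (xs, ys)) q = decoder_output W dX dY"
proof -
  show mid: "map_pmf (\<lambda>(_, w, _). w) q = W"
    by (simp add: q_def map_bind_pmf map_pmf_comp split_beta bind_return_pmf')
  show "map_pmf (\<lambda>(xs, _, ys). (xs, ys)) q = decoder_output W dX dY"
    by (simp add: q_def map_bind_pmf map_pmf_comp split_beta decoder_output_def)
  \<comment> \<open>A general \<open>P\<close> covers the joint event and both marginal events; the
    constant \<open>True\<close> gives the denominator of the conditional probabilities.\<close>
  have prob: "measure q {(xs, w', ys). P xs ys \<and> w' = w} =
      pmf W w * measure (pair_pmf (dX w) (dY w)) {(xs, ys). P xs ys}" for P w
  proof -
    have "emeasure q {(xs, w', ys). P xs ys \<and> w' = w} =
        (\<integral>\<^sup>+ v. emeasure (pair_pmf (dX w) (dY w)) {(xs, ys). P xs ys} * indicator {w} v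
          \<partial>measure_pmf W)"
      unfolding q_def emeasure_bind_pmf
      by (intro nn_integral_cong) (auto simp: vimage_def case_prod_unfold indicator_def)
    also have "\<dots> = ennreal (pmf W w * measure (pair_pmf (dX w) (dY w)) {(xs, ys). P xs ys})"
      by (subst nn_integral_cmult)
         (auto simp: measure_pmf.emeasure_eq_measure measure_pmf_single ennreal_mult mult.commute)
    finally show ?thesis
      by (simp add: measure_pmf.emeasure_eq_measure)
  qed
  have cond: "\<P>((xs, w', ys) in measure_pmf q. P xs ys \<bar> w' = w) =
      measure (pair_pmf (dX w) (dY w)) {(xs, ys). P xs ys}" if "w \<in> set_pmf W" for P w
    using that prob[of P w] prob[of "\<lambda>_ _. True" w] unfolding cond_prob_def
    by (simp add: case_prod_unfold set_pmf_iff)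
  show "markov_chain q"
    unfolding markov_chain_def mid
  proof (intro ballI allI)
    fix w a b
    assume w: "w \<in> set_pmf W"
    let ?D = "pair_pmf (dX w) (dY w)"
    have "measure ?D {(xs, ys). xs = a \<and> ys = b} = pmf ?D (a, b)"
      by (auto simp: measure_pmf_single[symmetric] intro!: arg_cong[where f = "measure ?D"])
    also have "\<dots> = pmf (map_pmf fst ?D) a * pmf (map_pmf snd ?D) b"
      by (simp add: pmf_pair map_fst_pair_pmf map_snd_pair_pmf)
    also have "\<dots> = measure ?D {(xs, ys). xs = a} * measure ?D {(xs, ys). ys = b}"
      by (simp add: pmf_map vimage_def case_prod_unfold)
    finally show "\<P>((a', w', b') in measure_pmf q. a' = a \<and> b' = b \<bar> w' = w) =
        \<P>((a', w', b') in measure_pmf q. a' = a \<bar> w' = w) *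
        \<P>((a', w', b') in measure_pmf q. b' = b \<bar> w' = w)"
      unfolding cond[OF w] .
  qed
qed

lemma common_entropy_le:
  assumes "decoder_output W dX dY = iid_source n p"
  shows "common_entropy n p \<le> shannon_entropy W"
  unfolding common_entropy_def
  by (rule INF_lower2[of "bind_pmf W (\<lambda>w. map_pmf (\<lambda>(xs, ys). (xs, w, ys)) (pair_pmf (dX w) (dY w)))"])
     (simp_all add: decoders_imp_markov_chain assms)

text \<open>Both translations preserve the law of \<open>W\<close>, so the later arguments can work
  with decoders instead of Markov chains.\<close>

lemma common_entropy_eq_INF_decoders:
  "common_entropy n p =
     (INF W \<in> {W. \<exists>dX dY. decoder_output W dX dY = iid_source n p}. shannon_entropy W)"
proof (rule antisym)
  show "common_entropy n p \<le>
      (INF W \<in> {W. \<exists>dX dY. decoder_output W dX dY = iid_source n p}. shannon_entropy W)"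
    by (intro INF_greatest) (auto intro: common_entropy_le)
  show "(INF W \<in> {W. \<exists>dX dY. decoder_output W dX dY = iid_source n p}. shannon_entropy W) \<le>
      common_entropy n p"
    unfolding common_entropy_def
  proof (intro INF_greatest)
    fix q :: "('a list \<times> nat \<times> 'b list) pmf"
    assume q: "q \<in> {q. map_pmf (\<lambda>(xs, _, ys). (xs, ys)) q = iid_source n p \<and> markov_chain q}"
    then obtain dX dY
      where "decoder_output (map_pmf (\<lambda>(_, w, _). w) q) dX dY = iid_source n p"
      using markov_chain_imp_decoders[of q] by auto
    then show "(INF W \<in> {W. \<exists>dX dY. decoder_output W dX dY = iid_source n p}. shannon_entropy W) \<le>
        shannon_entropy (map_pmf (\<lambda>(_, w, _). w) q)"
      by (intro INF_lower) auto
  qed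
qed

section \<open>The entropy rate as an infimum\<close>

text \<open>The whole block can serve as common variable: number its finitely many values by
  \<open>f\<close> and let each decoder read off its own coordinate.\<close>

lemma common_entropy_finite:
  assumes "finite (set_pmf p)"
  shows "common_entropy n p < \<top>"
proof -
  define Q where "Q = iid_source n p"
  have fin: "finite (set_pmf Q)"
    using assms finite_lists_length_eq[of "set_pmf p" n]
    by (simp add: Q_def iid_source_def set_replicate_pmf lists_eq_set)
  then obtain f :: "'a list \<times> 'b list \<Rightarrow> nat" where f: "inj_on f (set_pmf Q)"
    using finite_imp_inj_to_nat_seg by blast
  define g where "g = inv_into (set_pmf Q) f"
  have "decoder_output (map_pmf f Q) (\<lambda>w. return_pmf (fst (g w))) (\<lambda>w. return_pmf (snd (g w))) =
      bind_pmf Q return_pmf"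
    unfolding decoder_output_def bind_map_pmf
    by (intro bind_pmf_cong) (auto simp: g_def f)
  then have "common_entropy n p \<le> shannon_entropy (map_pmf f Q)"
    by (intro common_entropy_le) (simp add: Q_def bind_return_pmf')
  also have "\<dots> < \<top>"
    using fin by (intro shannon_entropy_finite) simp
  finally show ?thesis .
qed

lemma iid_source_add:
  "iid_source (m + n) p =
     bind_pmf (iid_source m p) (\<lambda>(xs, ys). bind_pmf (iid_source n p) (\<lambda>(xs', ys').
       return_pmf (xs @ xs', ys @ ys')))"
  by (simp add: iid_source_def replicate_pmf_distrib map_bind_pmf bind_map_pmf)

text \<open>Use independent common variables for the two blocks, decode each block separately and
  concatenate.\<close>

lemma common_entropy_subadditive:
  "common_entropy (m + n) p \<le> common_entropy m p + common_entropy n p"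
proof -
  have prod: "common_entropy (m + n) p \<le> shannon_entropy V + shannon_entropy W"
    if V: "decoder_output V dX dY = iid_source m p"
      and W: "decoder_output W eX eY = iid_source n p" for V W dX dY eX eY
  proof -
    \<comment> \<open>Common variables are \<open>nat\<close>-valued, so the pair is encoded
      injectively, which preserves entropy.\<close>
    define U where "U = map_pmf prod_encode (pair_pmf V W)"
    define fX where "fX u = (case prod_decode u of (v, w) \<Rightarrow>
        map_pmf (\<lambda>(xs, xs'). xs @ xs') (pair_pmf (dX v) (eX w)))" for u
    define fY where "fY u = (case prod_decode u of (v, w) \<Rightarrow>
        map_pmf (\<lambda>(ys, ys'). ys @ ys') (pair_pmf (dY v) (eY w)))" for u
    have "decoder_output U fX fY =
        bind_pmf V (\<lambda>v. bind_pmf W (\<lambda>w. bind_pmf (dX v) (\<lambda>xs. bind_pmf (eX w) (\<lambda>xs'.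
          bind_pmf (dY v) (\<lambda>ys. bind_pmf (eY w) (\<lambda>ys'. return_pmf (xs @ xs', ys @ ys')))))))"
      by (simp add: decoder_output_def U_def fX_def fY_def bind_map_pmf map_pmf_def pair_pmf_def
          bind_assoc_pmf bind_return_pmf)
    also have "\<dots> =
        bind_pmf V (\<lambda>v. bind_pmf (dX v) (\<lambda>xs. bind_pmf (dY v) (\<lambda>ys. bind_pmf W (\<lambda>w.
          bind_pmf (eX w) (\<lambda>xs'. bind_pmf (eY w) (\<lambda>ys'. return_pmf (xs @ xs', ys @ ys')))))))"
    proof -
      \<comment> \<open>Independent draws commute: the draws for the first block move ahead of those
        for the second.\<close>
      have "bind_pmf W (\<lambda>w. bind_pmf (dX v) (\<lambda>xs. bind_pmf (eX w) (\<lambda>xs'.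
            bind_pmf (dY v) (\<lambda>ys. bind_pmf (eY w) (\<lambda>ys'. return_pmf (xs @ xs', ys @ ys')))))) =
          bind_pmf (dX v) (\<lambda>xs. bind_pmf (dY v) (\<lambda>ys. bind_pmf W (\<lambda>w.
            bind_pmf (eX w) (\<lambda>xs'. bind_pmf (eY w) (\<lambda>ys'. return_pmf (xs @ xs', ys @ ys'))))))" for v
        unfolding bind_commute_pmf[of "eX _" "dY v"]
        by (subst bind_commute_pmf, subst bind_commute_pmf[of W "dY v"]) (rule refl)
      then show ?thesis
        by simp
    qed
    also have "\<dots> = iid_source (m + n) p"
      unfolding iid_source_add V[symmetric] W[symmetric]
      by (simp add: decoder_output_def pair_pmf_def bind_assoc_pmf bind_return_pmf)
    finally have "common_entropy (m + n) p \<le> shannon_entropy U"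
      by (rule common_entropy_le)
    also have "\<dots> = shannon_entropy V + shannon_entropy W"
      by (simp add: U_def shannon_entropy_map_inj inj_prod_encode shannon_entropy_pair_pmf)
    finally show ?thesis .
  qed
  show ?thesis
  proof (rule ennreal_le_epsilon)
    fix e :: real
    assume fin: "common_entropy m p + common_entropy n p < \<top>" and "0 < e"
    then have e: "0 < ennreal (e / 2)"
      by simp
    \<comment> \<open>Each block gets a common variable within \<open>e / 2\<close> of the infimum;
      finiteness makes the inequalities strict.\<close>
    have "common_entropy m p < common_entropy m p + ennreal (e / 2)"
      "common_entropy n p < common_entropy n p + ennreal (e / 2)"
      using fin e by (auto simp: less_top ennreal_add_left_cancel_less[of _ 0, simplified])
    then obtain V dX dY W eX eY
      where "decoder_output V dX dY = iid_source m p"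
        and V: "shannon_entropy V < common_entropy m p + ennreal (e / 2)"
        and "decoder_output W eX eY = iid_source n p"
        and W: "shannon_entropy W < common_entropy n p + ennreal (e / 2)"
      by (subst (asm) (1 3) common_entropy_eq_INF_decoders) (auto simp: INF_less_iff)
    then have "common_entropy (m + n) p \<le> shannon_entropy V + shannon_entropy W"
      by (intro prod)
    also have "\<dots> \<le> (common_entropy m p + ennreal (e / 2)) + (common_entropy n p + ennreal (e / 2))"
      using V W by (intro add_mono) auto
    also have "\<dots> = common_entropy m p + common_entropy n p + ennreal (e / 2 + e / 2)"
      using \<open>0 < e\<close> by (subst ennreal_plus) (auto simp: ac_simps)
    finally show "common_entropy (m + n) p \<le> common_entropy m p + common_entropy n p + ennreal e"
      by simp
  qed
qed

lemma tendsto_const_divide_of_nat_ennreal: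
  fixes C :: ennreal
  assumes "C < \<top>"
  shows "(\<lambda>n. C / of_nat n) \<longlonglongrightarrow> 0"
proof -
  obtain c where c: "C = ennreal c" "0 \<le> c"
    using assms by (cases C) auto
  have "(\<lambda>n. ennreal (c / real n)) \<longlonglongrightarrow> ennreal 0"
    by (intro tendsto_ennrealI lim_const_over_n)
  moreover have "eventually (\<lambda>n. ennreal (c / real n) = C / of_nat n) sequentially"
    using eventually_gt_at_top[of 0]
    by eventually_elim (simp add: c divide_ennreal ennreal_of_nat_eq_real_of_nat)
  ultimately show ?thesis
    by (simp add: tendsto_cong)
qed

text \<open>Fekete's argument: for fixed \<open>m\<close>, divide \<open>n\<close> by
  \<open>m\<close> with remainder. The quotient part contributes at most
  \<open>a m / of_nat m\<close> per unit length, and the remainder vanishes in the limit.\<close>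

lemma fekete_ennreal:
  fixes a :: "nat \<Rightarrow> ennreal"
  assumes sub: "\<And>m n. a (m + n) \<le> a m + a n" and fin: "\<And>n. a n < \<top>"
  shows "(\<lambda>n. a n / of_nat n) \<longlonglongrightarrow> (INF n\<in>{1..}. a n / of_nat n)"
proof -
  let ?L = "INF n\<in>{1..}. a n / of_nat n"
  have upper: "limsup (\<lambda>n. a n / of_nat n) \<le> a m / of_nat m" if "m \<ge> 1" for m
  proof -
    \<comment> \<open>A bound on all remainder terms that does not depend on
      \<open>n\<close>.\<close>
    define C where "C = (\<Sum>r<m. a r)"
    have C: "C < \<top>"
      using fin by (simp add: C_def)
    have multiple: "a (q * m + r) \<le> of_nat q * a m + a r" for q r
    proof (induction q)
      case (Suc q)
      have "a (Suc q * m + r) \<le> a m + a (q * m + r)"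
        using sub[of m "q * m + r"] by (simp add: add.assoc)
      also have "\<dots> \<le> a m + (of_nat q * a m + a r)"
        using Suc by (intro add_left_mono)
      finally show ?case
        by (simp add: algebra_simps)
    qed simp
    have "a n / of_nat n \<le> a m / of_nat m + C / of_nat n" if "n \<ge> 1" for n
    proof -
      have n: "of_nat n \<noteq> (0 :: ennreal)" "of_nat n \<noteq> (\<top> :: ennreal)"
        and m: "of_nat m \<noteq> (0 :: ennreal)" "of_nat m \<noteq> (\<top> :: ennreal)"
        using \<open>n \<ge> 1\<close> \<open>m \<ge> 1\<close> by auto
      have am: "of_nat m * (a m / of_nat m) = a m"
        using m by (simp add: ennreal_times_divide mult.commute[of "of_nat m"] mult_divide_eq_ennreal)
      have "a n \<le> of_nat (n div m) * a m + a (n mod m)"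
        using multiple[of "n div m" "n mod m"] by simp
      also have "a (n mod m) \<le> C"
        unfolding C_def using \<open>m \<ge> 1\<close> by (intro member_le_sum) auto
      also have "of_nat (n div m) * a m = of_nat (n div m) * of_nat m * (a m / of_nat m)"
        by (simp add: mult.assoc am)
      also have "\<dots> \<le> of_nat n * (a m / of_nat m)"
        by (intro mult_right_mono) (simp_all add: div_times_less_eq_dividend flip: of_nat_mult)
      finally have "a n \<le> of_nat n * (a m / of_nat m) + C"
        by (simp add: add_right_mono)
      then have "a n / of_nat n \<le> (of_nat n * (a m / of_nat m) + C) / of_nat n"
        by (rule divide_right_mono_ennreal)
      also have "\<dots> = a m / of_nat m + C / of_nat n"
        using n by (simp add: add_divide_distrib_ennreal mult.commute[of "of_nat n"]
            mult_divide_eq_ennreal)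
      finally show ?thesis .
    qed
    then have "limsup (\<lambda>n. a n / of_nat n) \<le> limsup (\<lambda>n. a m / of_nat m + C / of_nat n)"
      by (intro Limsup_mono eventually_sequentiallyI[of 1])
    also have "\<dots> = a m / of_nat m + 0"
      using C by (intro lim_imp_Limsup tendsto_add tendsto_const tendsto_const_divide_of_nat_ennreal) auto
    finally show ?thesis
      by simp
  qed
  have "limsup (\<lambda>n. a n / of_nat n) \<le> ?L"
    using upper by (intro INF_greatest) auto
  moreover have "?L \<le> liminf (\<lambda>n. a n / of_nat n)"
    by (intro Liminf_bounded eventually_sequentiallyI[of 1] INF_lower) auto
  moreover have "liminf (\<lambda>n. a n / of_nat n) \<le> limsup (\<lambda>n. a n / of_nat n)"
    by (intro Liminf_le_Limsup) auto
  ultimately show ?thesis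
    by (intro Liminf_eq_Limsup) (auto intro: antisym order_trans)
qed

section \<open>Exact generation\<close>

text \<open>The definition compares probabilities only at words of length \<open>n\<close>; all
  other pairs have probability 0 on both sides, by the length clauses of the code and by
  construction of the source.\<close>

lemma exactly_generates_iff:
  assumes "simulation_code W R n dX dY"
  shows "exactly_generates n p W dX dY \<longleftrightarrow> decoder_output W dX dY = iid_source n p"
proof
  assume gen: "exactly_generates n p W dX dY"
  show "decoder_output W dX dY = iid_source n p"
  proof (rule pmf_eqI, clarify)
    fix xs ys
    show "pmf (decoder_output W dX dY) (xs, ys) = pmf (iid_source n p) (xs, ys)"
    proof (cases "length xs = n \<and> length ys = n")
      case True
      then show ?thesis
        using gen by (simp add: exactly_generates_def pmf_iid_source)
    next
      case False
      then have "(xs, ys) \<notin> set_pmf (decoder_output W dX dY)"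
        using assms by (auto simp: simulation_code_def decoder_output_def)
      moreover have "(xs, ys) \<notin> set_pmf (iid_source n p)"
        using False by (auto simp: iid_source_def set_replicate_pmf)
      ultimately show ?thesis
        by (simp add: set_pmf_iff)
    qed
  qed
qed (simp add: exactly_generates_def pmf_iid_source)

text \<open>For each \<open>w\<close>, the product of the decoder supports lies in the source
  support; nonempty factors allow projection. This supplies the length clauses of
  \<open>simulation_code\<close>.\<close>

lemma decoder_output_eq_iid_source_length:
  assumes "decoder_output W dX dY = iid_source n p" "w \<in> set_pmf W"
  shows "\<forall>xs\<in>set_pmf (dX w). length xs = n" "\<forall>ys\<in>set_pmf (dY w). length ys = n"
proof -
  have "set_pmf (dX w) \<times> set_pmf (dY w) \<subseteq> set_pmf (iid_source n p)"
    using assms(2) unfolding assms(1)[symmetric] decoder_output_def by auto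
  also have "\<dots> \<subseteq> {xs. length xs = n} \<times> {ys. length ys = n}"
    by (auto simp: iid_source_def set_replicate_pmf)
  finally show "\<forall>xs\<in>set_pmf (dX w). length xs = n" "\<forall>ys\<in>set_pmf (dY w). length ys = n"
    using set_pmf_not_empty[of "dX w"] set_pmf_not_empty[of "dY w"] by blast+
qed

text \<open>Converse half: every prefix-free code for \<open>W\<close> pays at least its entropy,
  hence so does the infimum over codes.\<close>

lemma rate_ge_common_entropy:
  assumes "simulation_code W R n dX dY" "exactly_generates n p W dX dY"
  shows "common_entropy n p / of_nat n \<le> R"
proof -
  have "common_entropy n p \<le> shannon_entropy W"
    using assms by (intro common_entropy_le) (simp add: exactly_generates_iff)
  also have "\<dots> \<le> (INF c \<in> {c. prefix_free_code W c}. expected_length W c)"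
    by (intro INF_greatest entropy_le_expected_length) simp
  finally show ?thesis
    using assms(1) by (simp add: simulation_code_def divide_right_mono_ennreal)
qed

text \<open>Achievability half: any decoders producing the source give a simulation code, and
  Shannon-Fano-Elias coding costs at most 2 bits per block above the entropy.\<close>

lemma exact_rate_le_common_entropy:
  assumes "n \<ge> 1"
  shows "exact_common_information_rate p \<le> (common_entropy n p + 2) / of_nat n"
proof -
  have "exact_common_information_rate p * of_nat n \<le> shannon_entropy W + 2"
    if "decoder_output W dX dY = iid_source n p" for W dX dY
  proof -
    define R where "R = (INF c \<in> {c. prefix_free_code W c}. expected_length W c) / of_nat n"
    have "simulation_code W R n dX dY"
      using decoder_output_eq_iid_source_length[OF that] by (simp add: simulation_code_def R_def)
    moreover from this have "exactly_generates n p W dX dY"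
      using that by (simp add: exactly_generates_iff)
    ultimately have "exact_common_information_rate p \<le> R"
      using assms unfolding exact_common_information_rate_def exactly_generated_at_rate_def
      by (intro Inf_lower) blast
    then have "exact_common_information_rate p * of_nat n \<le> R * of_nat n"
      by (rule mult_right_mono) simp
    also have "\<dots> = (INF c \<in> {c. prefix_free_code W c}. expected_length W c)"
      using assms ennreal_divide_self[of "of_nat n"]
      by (simp add: R_def ennreal_divide_times of_nat_less_top)
    also have "\<dots> \<le> shannon_entropy W + 2"
      using exists_prefix_free_code[of W] by (auto intro: INF_lower2)
    finally show ?thesis .
  qed
  \<comment> \<open>With the 2 moved left, the bound holds below every admissible entropy and so
    passes to the infimum.\<close>
  then have "exact_common_information_rate p * of_nat n - 2 \<le> common_entropy n p"
    unfolding common_entropy_eq_INF_decoders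
    by (intro INF_greatest) (auto simp: ennreal_minus_le_iff add.commute)
  then have "exact_common_information_rate p * of_nat n \<le> common_entropy n p + 2"
    by (simp add: ennreal_minus_le_iff add.commute)
  then have "exact_common_information_rate p * of_nat n / of_nat n \<le>
      (common_entropy n p + 2) / of_nat n"
    by (rule divide_right_mono_ennreal)
  then show ?thesis
    using assms by (simp add: mult_divide_eq_ennreal)
qed

theorem proposition2:
  fixes p :: "('a::finite \<times> 'b::finite) pmf"
  shows "exact_common_information_rate p = common_entropy_rate p"
proof -
  let ?L = "INF n\<in>{1..}. common_entropy n p / of_nat n"
  have lim: "(\<lambda>n. common_entropy n p / of_nat n) \<longlonglongrightarrow> ?L"
    by (intro fekete_ennreal common_entropy_subadditive common_entropy_finite) simp
  \<comment> \<open>The 2-bit overhead is paid once per block, so per symbol it tends to 0.\<close>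
  have "(\<lambda>n. common_entropy n p / of_nat n + 2 / of_nat n) \<longlonglongrightarrow> ?L + 0"
    by (intro tendsto_add lim tendsto_const_divide_of_nat_ennreal) simp
  then have "exact_common_information_rate p \<le> ?L"
    using exact_rate_le_common_entropy[of _ p]
    by (intro LIMSEQ_le_const[where X = "\<lambda>n. common_entropy n p / of_nat n + 2 / of_nat n"] exI[of _ 1])
       (auto simp: add_divide_distrib_ennreal)
  moreover have "?L \<le> exact_common_information_rate p"
    unfolding exact_common_information_rate_def exactly_generated_at_rate_def
    by (intro Inf_greatest) (auto intro: INF_lower2 rate_ge_common_entropy)
  ultimately show ?thesis
    using limI[OF lim] by (simp add: common_entropy_rate_def)
qed

end
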